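(* Let $u_{ex}\in Z$ be the exact solution of a problem. Let $(X^{(p)},\|\cdot\|_{X^{(p)}})$, $p\in\mathbb{N}=\{0,1,2,\dots\}$, and $(Y^{(p)},\|\cdot\|_{Y^{(p)}})$, $p\ge 1$, be normed vector spaces. For every $p\ge 1$ let $\mathcal{L}^{1,(p)}_\Delta,\mathcal{L}^{2,(p)}_\Delta:X^{(p)}\to Y^{(p)}$ be two operators depending on the same parameter $\Delta>0$ and such that, for some constants $\alpha_1^{(p)},\alpha_2^{(p)}>0$ independent of $\Delta$: (i) there exists a unique $u_\Delta^{(p)}\in X^{(p)}$ with $\mathcal{L}^{2,(p)}_\Delta(u_\Delta^{(p)})=0_{Y^{(p)}}$; (ii) $\|\mathcal{L}^{1,(p)}_\Delta(v)-\mathcal{L}^{1,(p)}_\Delta(w)\|_{Y^{(p)}}\ge \alpha_1^{(p)}\|v-w\|_{X^{(p)}}$ for all $v,w\in X^{(p)}$; (iii) $\big\|[\mathcal{L}^{1,(p)}_\Delta(v)-\mathcal{L}^{2,(p)}_\Delta(v)]-[\mathcal{L}^{1,(p)}_\Delta(w)-\mathcal{L}^{2,(p)}_\Delta(w)]\big\|_{Y^{(p)}}\le \alpha_2^{(p)}\Delta\|v-w\|_{X^{(p)}}$ for all $v,w\in X^{(p)}$. Assume that for every $p\in\mathbb{N}$ there are an embedding operator $\mathcal{E}^{(p)}:X^{(p)}\to X^{(p+1)}$, associating to each $u^{(p)}\in X^{(p)}$ the element $u^{*(p)}:=\mathcal{E}^{(p)}(u^{(p)})\in X^{(p+1)}$,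 and a projection $\Pi^{(p)}:Z\to X^{(p)}$, and set $u_{ex}^{(p)}:=\Pi^{(p)}(u_{ex})\in X^{(p)}$. Given $u^{(0)}\in X^{(0)}$, define for $p\ge 1$ the sequence $u^{(p)}\in X^{(p)}$ by $$u^{*(p-1)}:=\mathcal{E}^{(p-1)}(u^{(p-1)}),\qquad \mathcal{L}^{1,(p)}_\Delta(u^{(p)}):=\mathcal{L}^{1,(p)}_\Delta(u^{*(p-1)})-\mathcal{L}^{2,(p)}_\Delta(u^{*(p-1)}).$$ Suppose that: 1. $\|u_\Delta^{(p)}-u_{ex}^{(p)}\|_{X^{(p)}}=O(\Delta^{p+1})$ for all $p\ge 1$; 2. $\|u^{*(p)}-u_{ex}^{(p+1)}\|_{X^{(p+1)}}\le C\,\|u^{(p)}-u_{ex}^{(p)}\|_{X^{(p)}}$ for all $p\in\mathbb{N}$, for some constant $C$ independent of $\Delta$; 3. $\|u^{(0)}-u_{ex}^{(0)}\|_{X^{(0)}}=O(\Delta)$. Then $\|u^{(p)}-u_{ex}^{(p)}\|_{X^{(p)}}=O(\Delta^{p+1})$ for all $p\in\mathbb{N}$.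
   Context: All $O(\cdot)$ symbols are meant as $\Delta\to 0^+$; the elements $u_\Delta^{(p)}$, $u^{(p)}$ (including $u^{(0)}$) may depend on $\Delta$. $Z$ is the space in which the exact solution lives; $0_{Y^{(p)}}$ is the zero vector of $Y^{(p)}$. Standing assumption on the low order operator: for every $z\in Y^{(p)}$ the problem $\mathcal{L}^{1,(p)}_\Delta(\tilde u)=z$ can be solved for $\tilde u\in X^{(p)}$ (uniqueness follows from (ii)), so that the iteration is well defined. *)

theory Defs
  imports
    Complex_Main
    "HOL-Library.Landau_Symbols"
    "HOL-Algebra.Algebraic_Closure_Type"
begin

text \<open>
  The statement concerns two sequences of normed vector spaces that need not be related to each
  other, so a normed space has to be a first-class value rather than a type.  A normed space is a
  vector space with explicit carrier and operations (a \<^locale>\<open>module\<close> over the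
  field of scalars) together with a norm; the norm axioms are those of the class
  \<^class>\<open>real_normed_vector\<close>, relativised to the carrier.  In a sequence \<open>\<X>\<close> of such spaces,
  each \<open>\<X> p\<close> has its own carrier, operations and norm; the shared element type
  imposes no relation between different members.

  The scalars are a type of class \<^class>\<open>real_normed_field\<close>, which covers both the real and the
  complex numbers.
\<close>

record ('k, 'v) normed_module = "('k, 'v) module" +
  vnorm :: "'v \<Rightarrow> real"

locale normed_space = module "ring_of_type_algebra :: 'k ring" V
  for V :: "('k :: real_normed_field, 'v) normed_module" (structure) +
  assumes vnorm_eq_zero:
      "v \<in> carrier V \<Longrightarrow> vnorm V v = 0 \<longleftrightarrow> v = \<zero>\<^bsub>V\<^esub>"
    and vnorm_triangle:
      "\<lbrakk>v \<in> carrier V; w \<in> carrier V\<rbrakk> \<Longrightarrow> vnorm V (v \<oplus>\<^bsub>V\<^esub> w) \<le> vnorm V v + vnorm V w"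
    and vnorm_smult:
      "v \<in> carrier V \<Longrightarrow> vnorm V (a \<odot>\<^bsub>V\<^esub> v) = norm a * vnorm V v"

lemma (in normed_space) vnorm_nonneg:
  assumes v: "v \<in> carrier V"
  shows "vnorm V v \<ge> 0"
proof -
  have in_R: "a \<in> carrier (ring_of_type_algebra :: 'k ring)" for a
    by (simp add: ring_of_type_algebra_def)
  have "(- 1 :: 'k) \<odot>\<^bsub>V\<^esub> v \<oplus>\<^bsub>V\<^esub> v = (- 1 :: 'k) \<odot>\<^bsub>V\<^esub> v \<oplus>\<^bsub>V\<^esub> (1 :: 'k) \<odot>\<^bsub>V\<^esub> v"
    using smult_one[OF v] by (simp add: ring_of_type_algebra_def)
  also have "\<dots> = (0 :: 'k) \<odot>\<^bsub>V\<^esub> v"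
    using smult_l_distr[OF in_R in_R v, of "- 1" 1] by (simp add: ring_of_type_algebra_def)
  finally have "vnorm V ((- 1 :: 'k) \<odot>\<^bsub>V\<^esub> v \<oplus>\<^bsub>V\<^esub> v) = 0"
    using vnorm_smult[OF v, of 0] by simp
  moreover have "vnorm V ((- 1 :: 'k) \<odot>\<^bsub>V\<^esub> v \<oplus>\<^bsub>V\<^esub> v) \<le> vnorm V v + vnorm V v"
    using vnorm_triangle[OF smult_closed[OF in_R v] v, of "- 1"] vnorm_smult[OF v, of "- 1"] by simp
  ultimately show ?thesis by simp
qed

lemma normed_space_type_class:
  "normed_space \<lparr>carrier = UNIV :: 'v :: real_normed_vector set, monoid.mult = m, one = e,
     ring.zero = 0, add = (+), module.smult = (\<lambda>a :: real. scaleR a), vnorm = norm\<rparr>"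
    (is "normed_space ?V")
proof (intro normed_space.intro moduleI normed_space_axioms.intro)
  show "cring (ring_of_type_algebra :: real ring)"
    by (rule cring_from_type_algebra)
  show "abelian_group ?V"
    by (rule abelian_groupI) (auto simp: algebra_simps intro: exI[of _ "- x" for x])
qed (auto simp: ring_of_type_algebra_def scaleR_add_left scaleR_add_right norm_triangle_ineq)

end

theory Submission
  imports Defs
begin

text \<open>
  Since \<open>L2\<close> vanishes at \<open>u\<Delta>\<close>, the iteration says that \<open>L1 u - L1 u\<Delta>\<close> is the increment
  of \<open>L1 - L2\<close> between \<open>u\<Delta>\<close> and the embedded previous iterate.  Coercivity of \<open>L1\<close> and the
  \<open>O(\<Delta>)\<close> Lipschitz constant of \<open>L1 - L2\<close> thus make every step a contraction towards \<open>u\<Delta>\<close> with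
  factor \<open>O(\<Delta>)\<close>, which gains one order until the accuracy of \<open>u\<Delta>\<close> itself is reached.
\<close>

context normed_space
begin

text \<open>The additive inverse is scalar multiplication by \<open>- 1\<close>, a scalar of norm 1,
  so homogeneity of the norm applies.\<close>

lemma vnorm_a_inv:
  assumes v: "v \<in> carrier V"
  shows "vnorm V (\<ominus>\<^bsub>V\<^esub> v) = vnorm V v"
proof -
  let ?K = "ring_of_type_algebra :: 'k ring"
  have in_K: "a \<in> carrier ?K" for a
    by (simp add: ring_of_type_algebra_def)
  have "(- 1 :: 'k) \<odot>\<^bsub>V\<^esub> v \<oplus>\<^bsub>V\<^esub> v = (- 1 :: 'k) \<odot>\<^bsub>V\<^esub> v \<oplus>\<^bsub>V\<^esub> (1 :: 'k) \<odot>\<^bsub>V\<^esub> v"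
    using smult_one[OF v] by (simp add: ring_of_type_algebra_def)
  also have "\<dots> = (0 :: 'k) \<odot>\<^bsub>V\<^esub> v"
    using smult_l_distr[OF in_K in_K v, of "- 1" 1] by (simp add: ring_of_type_algebra_def)
  \<comment> \<open>By homogeneity this vector has norm 0, so definiteness of the norm identifies it
    as the zero vector.\<close>
  also have "\<dots> = \<zero>\<^bsub>V\<^esub>"
    using vnorm_smult[OF v, of 0] vnorm_eq_zero[OF smult_closed[OF in_K v], of 0] by simp
  finally have "\<ominus>\<^bsub>V\<^esub> v = (- 1 :: 'k) \<odot>\<^bsub>V\<^esub> v"
    using M.minus_equality[of "(- 1 :: 'k) \<odot>\<^bsub>V\<^esub> v" v] smult_closed[OF in_K v] v by simp
  then show ?thesis
    using vnorm_smult[OF v, of "- 1"] by simp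
qed

lemma vnorm_minus_commute:
  assumes "v \<in> carrier V" "w \<in> carrier V"
  shows "vnorm V (v \<ominus>\<^bsub>V\<^esub> w) = vnorm V (w \<ominus>\<^bsub>V\<^esub> v)"
proof -
  have "\<ominus>\<^bsub>V\<^esub> (v \<ominus>\<^bsub>V\<^esub> w) = w \<ominus>\<^bsub>V\<^esub> v"
    using assms by (simp add: a_minus_def M.minus_add M.a_comm)
  then show ?thesis
    using vnorm_a_inv[of "v \<ominus>\<^bsub>V\<^esub> w"] assms by simp
qed

lemma vnorm_minus_triangle:
  assumes "v \<in> carrier V" "w \<in> carrier V" "x \<in> carrier V"
  shows "vnorm V (v \<ominus>\<^bsub>V\<^esub> x) \<le> vnorm V (v \<ominus>\<^bsub>V\<^esub> w) + vnorm V (w \<ominus>\<^bsub>V\<^esub> x)"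
proof -
  have "(v \<ominus>\<^bsub>V\<^esub> w) \<oplus>\<^bsub>V\<^esub> (w \<ominus>\<^bsub>V\<^esub> x) = v \<ominus>\<^bsub>V\<^esub> x"
    using assms by (simp add: a_minus_def M.a_assoc M.r_neg1)
  then show ?thesis
    using vnorm_triangle[of "v \<ominus>\<^bsub>V\<^esub> w" "w \<ominus>\<^bsub>V\<^esub> x"] assms by simp
qed

end

text \<open>One step of the iteration at a fixed level and a fixed \<Delta>: \<open>A\<close> and
  \<open>B\<close> stand for \<open>L1\<close> and \<open>L2\<close>, \<open>v\<close> for the
  embedded previous iterate, \<open>z\<close> for the zero of \<open>L2\<close>, \<open>x\<close>
  for the projected exact solution. The contraction is towards \<open>z\<close>, but the error is
  measured from \<open>x\<close>, because the assumptions on the embedding and on the accuracy refer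
  to \<open>x\<close>; each change of reference point costs one distance from \<open>z\<close> to
  \<open>x\<close>.\<close>

lemma corrected_step_error:
  fixes V :: "('k :: real_normed_field, 'x) normed_module"
    and W :: "('k, 'y) normed_module"
  assumes "normed_space V" "normed_space W"
    and A: "A \<in> carrier V \<rightarrow> carrier W"
    and a_pos: "a > 0" and b_nonneg: "b \<ge> 0"
    and coercive: "\<And>v w. v \<in> carrier V \<Longrightarrow> w \<in> carrier V \<Longrightarrow>
      a * vnorm V (v \<ominus>\<^bsub>V\<^esub> w) \<le> vnorm W (A v \<ominus>\<^bsub>W\<^esub> A w)"
    and lipschitz: "\<And>v w. v \<in> carrier V \<Longrightarrow> w \<in> carrier V \<Longrightarrow>
      vnorm W ((A v \<ominus>\<^bsub>W\<^esub> B v) \<ominus>\<^bsub>W\<^esub> (A w \<ominus>\<^bsub>W\<^esub> B w)) \<le> b * vnorm V (v \<ominus>\<^bsub>V\<^esub> w)"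
    and carrier: "u \<in> carrier V" "v \<in> carrier V" "z \<in> carrier V" "x \<in> carrier V"
    and zero: "B z = \<zero>\<^bsub>W\<^esub>"
    and step: "A u = A v \<ominus>\<^bsub>W\<^esub> B v"
  shows "vnorm V (u \<ominus>\<^bsub>V\<^esub> x) \<le>
    b / a * (vnorm V (v \<ominus>\<^bsub>V\<^esub> x) + vnorm V (z \<ominus>\<^bsub>V\<^esub> x)) + vnorm V (z \<ominus>\<^bsub>V\<^esub> x)"
proof -
  interpret V: normed_space V by fact
  interpret W: normed_space W by fact
  have "A z \<in> carrier W"
    using A carrier by blast
  \<comment> \<open>This turns \<open>A u\<close> minus \<open>A z\<close> into the increment of
    \<open>A - B\<close> from \<open>z\<close> to \<open>v\<close>, to which the Lipschitz bound
    applies.\<close>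
  then have "A z \<ominus>\<^bsub>W\<^esub> B z = A z"
    by (simp add: zero a_minus_def)
  then have "a * vnorm V (u \<ominus>\<^bsub>V\<^esub> z) \<le> b * vnorm V (v \<ominus>\<^bsub>V\<^esub> z)"
    using coercive[of u z] lipschitz[of v z] carrier step by simp
  also have "\<dots> \<le> b * (vnorm V (v \<ominus>\<^bsub>V\<^esub> x) + vnorm V (z \<ominus>\<^bsub>V\<^esub> x))"
    using V.vnorm_minus_triangle[of v x z] V.vnorm_minus_commute[of x z] carrier b_nonneg
    by (intro mult_left_mono) auto
  finally have "vnorm V (u \<ominus>\<^bsub>V\<^esub> z) \<le> b / a * (vnorm V (v \<ominus>\<^bsub>V\<^esub> x) + vnorm V (z \<ominus>\<^bsub>V\<^esub> x))"
    using a_pos by (simp add: field_simps)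
  then show ?thesis
    using V.vnorm_minus_triangle[of u z x] carrier by simp
qed

theorem theorem2:
  fixes \<X> :: "nat \<Rightarrow> ('k :: real_normed_field, 'x) normed_module"
    and \<Y> :: "nat \<Rightarrow> ('k, 'y) normed_module"
    and Z :: "'z set"
    and u_ex :: 'z
    and L1 L2 :: "nat \<Rightarrow> real \<Rightarrow> 'x \<Rightarrow> 'y"
    and \<alpha>1 \<alpha>2 :: "nat \<Rightarrow> real"
    and E :: "nat \<Rightarrow> 'x \<Rightarrow> 'x"
    and proj :: "nat \<Rightarrow> 'z \<Rightarrow> 'x"
    and u\<Delta> u :: "nat \<Rightarrow> real \<Rightarrow> 'x"
  assumes u_ex: "u_ex \<in> Z"
    and X: "\<And>p. normed_space (\<X> p)"
    and Y: "\<And>p. p \<ge> 1 \<Longrightarrow> normed_space (\<Y> p)"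
    and L1: "\<And>p \<Delta>. p \<ge> 1 \<Longrightarrow> \<Delta> > 0 \<Longrightarrow> L1 p \<Delta> \<in> carrier (\<X> p) \<rightarrow> carrier (\<Y> p)"
    and L2: "\<And>p \<Delta>. p \<ge> 1 \<Longrightarrow> \<Delta> > 0 \<Longrightarrow> L2 p \<Delta> \<in> carrier (\<X> p) \<rightarrow> carrier (\<Y> p)"
    and \<alpha>1_pos: "\<And>p. p \<ge> 1 \<Longrightarrow> \<alpha>1 p > 0"
    and \<alpha>2_pos: "\<And>p. p \<ge> 1 \<Longrightarrow> \<alpha>2 p > 0"
    and L1_solvable: "\<And>p \<Delta> z. p \<ge> 1 \<Longrightarrow> \<Delta> > 0 \<Longrightarrow> z \<in> carrier (\<Y> p) \<Longrightarrow>
      \<exists>v \<in> carrier (\<X> p). L1 p \<Delta> v = z"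
    and L2_unique_zero: "\<And>p \<Delta>. p \<ge> 1 \<Longrightarrow> \<Delta> > 0 \<Longrightarrow>
      \<exists>!v. v \<in> carrier (\<X> p) \<and> L2 p \<Delta> v = \<zero>\<^bsub>\<Y> p\<^esub>"
    and u\<Delta>: "\<And>p \<Delta>. p \<ge> 1 \<Longrightarrow> \<Delta> > 0 \<Longrightarrow>
      u\<Delta> p \<Delta> \<in> carrier (\<X> p) \<and> L2 p \<Delta> (u\<Delta> p \<Delta>) = \<zero>\<^bsub>\<Y> p\<^esub>"
    and L1_coercive: "\<And>p \<Delta> v w. p \<ge> 1 \<Longrightarrow> \<Delta> > 0 \<Longrightarrow>
      v \<in> carrier (\<X> p) \<Longrightarrow> w \<in> carrier (\<X> p) \<Longrightarrow>
      vnorm (\<Y> p) (L1 p \<Delta> v \<ominus>\<^bsub>\<Y> p\<^esub> L1 p \<Delta> w) \<ge> \<alpha>1 p * vnorm (\<X> p) (v \<ominus>\<^bsub>\<X> p\<^esub> w)"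
    and L1_L2_lipschitz: "\<And>p \<Delta> v w. p \<ge> 1 \<Longrightarrow> \<Delta> > 0 \<Longrightarrow>
      v \<in> carrier (\<X> p) \<Longrightarrow> w \<in> carrier (\<X> p) \<Longrightarrow>
      vnorm (\<Y> p) ((L1 p \<Delta> v \<ominus>\<^bsub>\<Y> p\<^esub> L2 p \<Delta> v) \<ominus>\<^bsub>\<Y> p\<^esub> (L1 p \<Delta> w \<ominus>\<^bsub>\<Y> p\<^esub> L2 p \<Delta> w))
        \<le> \<alpha>2 p * \<Delta> * vnorm (\<X> p) (v \<ominus>\<^bsub>\<X> p\<^esub> w)"
    and E: "\<And>p. E p \<in> carrier (\<X> p) \<rightarrow> carrier (\<X> (p + 1))"
    and proj: "\<And>p. proj p \<in> Z \<rightarrow> carrier (\<X> p)"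
    and u_carrier: "\<And>p \<Delta>. \<Delta> > 0 \<Longrightarrow> u p \<Delta> \<in> carrier (\<X> p)"
    and iteration: "\<And>p \<Delta>. p \<ge> 1 \<Longrightarrow> \<Delta> > 0 \<Longrightarrow>
      L1 p \<Delta> (u p \<Delta>) = L1 p \<Delta> (E (p - 1) (u (p - 1) \<Delta>)) \<ominus>\<^bsub>\<Y> p\<^esub> L2 p \<Delta> (E (p - 1) (u (p - 1) \<Delta>))"
    and accuracy: "\<And>p. p \<ge> 1 \<Longrightarrow>
      (\<lambda>\<Delta>. vnorm (\<X> p) (u\<Delta> p \<Delta> \<ominus>\<^bsub>\<X> p\<^esub> proj p u_ex)) \<in> O[at_right 0](\<lambda>\<Delta>. \<Delta> ^ (p + 1))"
    and embedding: "\<And>p. \<exists>C. \<forall>\<Delta>>0.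
      vnorm (\<X> (p + 1)) (E p (u p \<Delta>) \<ominus>\<^bsub>\<X> (p + 1)\<^esub> proj (p + 1) u_ex)
        \<le> C * vnorm (\<X> p) (u p \<Delta> \<ominus>\<^bsub>\<X> p\<^esub> proj p u_ex)"
    and initial: "(\<lambda>\<Delta>. vnorm (\<X> 0) (u 0 \<Delta> \<ominus>\<^bsub>\<X> 0\<^esub> proj 0 u_ex)) \<in> O[at_right 0](\<lambda>\<Delta>. \<Delta>)"
  shows "\<forall>p. (\<lambda>\<Delta>. vnorm (\<X> p) (u p \<Delta> \<ominus>\<^bsub>\<X> p\<^esub> proj p u_ex)) \<in> O[at_right 0](\<lambda>\<Delta>. \<Delta> ^ (p + 1))"
proof
  fix p
  have ex: "proj q u_ex \<in> carrier (\<X> q)" for q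
    using proj u_ex by blast
  \<comment> \<open>Landau symbols compare absolute values, so an upper bound on a norm is usable
    only together with its sign.\<close>
  have nonneg: "vnorm (\<X> q) (v \<ominus>\<^bsub>\<X> q\<^esub> w) \<ge> 0"
    if "v \<in> carrier (\<X> q)" "w \<in> carrier (\<X> q)" for q v w
  proof -
    interpret normed_space "\<X> q" by (rule X)
    show ?thesis using that by (intro vnorm_nonneg) simp
  qed
  show "(\<lambda>\<Delta>. vnorm (\<X> p) (u p \<Delta> \<ominus>\<^bsub>\<X> p\<^esub> proj p u_ex)) \<in> O[at_right 0](\<lambda>\<Delta>. \<Delta> ^ (p + 1))"
  proof (induction p)
    case 0
    then show ?case using initial by simp
  next
    case (Suc p)
    let ?q = "Suc p"
    let ?err = "\<lambda>\<Delta>. vnorm (\<X> p) (u p \<Delta> \<ominus>\<^bsub>\<X> p\<^esub> proj p u_ex)"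
    let ?acc = "\<lambda>\<Delta>. vnorm (\<X> ?q) (u\<Delta> ?q \<Delta> \<ominus>\<^bsub>\<X> ?q\<^esub> proj ?q u_ex)"
    obtain C where C: "\<And>\<Delta>. \<Delta> > 0 \<Longrightarrow>
        vnorm (\<X> ?q) (E p (u p \<Delta>) \<ominus>\<^bsub>\<X> ?q\<^esub> proj ?q u_ex) \<le> C * ?err \<Delta>"
      using embedding[of p] by auto
    \<comment> \<open>The Lipschitz constant \<open>\<alpha>2 ?q * \<Delta>\<close> is split so that
      the factor \<Delta>, the source of the extra order, stands apart from the constant
      ratio.\<close>
    let ?bound = "\<lambda>\<Delta>. \<alpha>2 ?q / \<alpha>1 ?q * (\<Delta> * (C * ?err \<Delta> + ?acc \<Delta>)) + ?acc \<Delta>"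
    have bound: "vnorm (\<X> ?q) (u ?q \<Delta> \<ominus>\<^bsub>\<X> ?q\<^esub> proj ?q u_ex) \<le> ?bound \<Delta>" if "\<Delta> > 0" for \<Delta>
    proof -
      have E_carrier: "E p (u p \<Delta>) \<in> carrier (\<X> ?q)"
        using E[of p] u_carrier[OF that, of p] by auto
      have "vnorm (\<X> ?q) (u ?q \<Delta> \<ominus>\<^bsub>\<X> ?q\<^esub> proj ?q u_ex) \<le>
          \<alpha>2 ?q * \<Delta> / \<alpha>1 ?q *
            (vnorm (\<X> ?q) (E p (u p \<Delta>) \<ominus>\<^bsub>\<X> ?q\<^esub> proj ?q u_ex) + ?acc \<Delta>) + ?acc \<Delta>"
      \<comment> \<open>Here \<open>a\<close> is \<open>\<alpha>1 ?q\<close> and \<open>b\<close> is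
        \<open>\<alpha>2 ?q * \<Delta>\<close>.\<close>
      proof (rule corrected_step_error[OF X Y L1])
        show "L1 ?q \<Delta> (u ?q \<Delta>) =
            L1 ?q \<Delta> (E p (u p \<Delta>)) \<ominus>\<^bsub>\<Y> ?q\<^esub> L2 ?q \<Delta> (E p (u p \<Delta>))"
          using iteration[of ?q \<Delta>] that by simp
      qed (use that \<alpha>1_pos[of ?q] \<alpha>2_pos[of ?q] L1_coercive L1_L2_lipschitz u\<Delta> u_carrier
        E_carrier ex in auto)
      also have "\<dots> \<le> \<alpha>2 ?q * \<Delta> / \<alpha>1 ?q * (C * ?err \<Delta> + ?acc \<Delta>) + ?acc \<Delta>"
        using C[OF that] that \<alpha>1_pos[of ?q] \<alpha>2_pos[of ?q]
        by (intro add_right_mono mult_left_mono) auto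
      finally show ?thesis by (simp add: mult_ac)
    qed
    have acc: "?acc \<in> O[at_right 0](\<lambda>\<Delta>. \<Delta> ^ (?q + 1))"
      using accuracy[of ?q] by simp
    \<comment> \<open>Inside the bracket the accuracy term is weakened to the order of the previous
      error, so that the two can be added; powers decrease with the exponent since \<Delta> <
      1.\<close>
    moreover have "(\<lambda>\<Delta>::real. \<Delta> ^ (?q + 1)) \<in> O[at_right 0](\<lambda>\<Delta>. \<Delta> ^ (p + 1))"
      by (intro bigoI[of _ 1] eventually_at_rightI[of 0 1])
        (auto intro!: power_decreasing simp flip: power_Suc)
    ultimately have "?acc \<in> O[at_right 0](\<lambda>\<Delta>. \<Delta> ^ (p + 1))"
      by (rule landau_o.big_trans)
    \<comment> \<open>The gain of one order: the bracket is of order \<open>p + 1\<close> by the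
      induction hypothesis, and the factor \<Delta> raises it to \<open>p + 2\<close>, that is
      \<open>?q + 1\<close>.\<close>
    then have "(\<lambda>\<Delta>. \<Delta> * (C * ?err \<Delta> + ?acc \<Delta>)) \<in> O[at_right 0](\<lambda>\<Delta>. \<Delta> * \<Delta> ^ (p + 1))"
      using Suc.IH by (intro landau_o.big.mult landau_o.big_refl sum_in_bigo) auto
    then have "(\<lambda>\<Delta>. \<alpha>2 ?q / \<alpha>1 ?q * (\<Delta> * (C * ?err \<Delta> + ?acc \<Delta>)))
        \<in> O[at_right 0](\<lambda>\<Delta>. \<Delta> ^ (?q + 1))"
      using \<alpha>1_pos[of ?q] \<alpha>2_pos[of ?q]
      by (subst landau_o.big.cmult_in_iff) auto
    \<comment> \<open>The accuracy term outside the bracket carries no factor \<Delta>, so here its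
      full order \<open>?q + 1\<close> is used.\<close>
    then have "?bound \<in> O[at_right 0](\<lambda>\<Delta>. \<Delta> ^ (?q + 1))"
      using acc by (rule sum_in_bigo)
    \<comment> \<open>The error is nonnegative and lies below \<open>?bound\<close>, hence also
      below its absolute value, so the constant 1 suffices.\<close>
    moreover have "(\<lambda>\<Delta>. vnorm (\<X> ?q) (u ?q \<Delta> \<ominus>\<^bsub>\<X> ?q\<^esub> proj ?q u_ex)) \<in> O[at_right 0](?bound)"
    proof (intro bigoI[of _ 1] eventually_at_rightI[of 0 1])
      fix \<Delta> :: real
      assume "\<Delta> \<in> {0<..<1}"
      then show "norm (vnorm (\<X> ?q) (u ?q \<Delta> \<ominus>\<^bsub>\<X> ?q\<^esub> proj ?q u_ex)) \<le> 1 * norm (?bound \<Delta>)"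
        using bound[of \<Delta>] nonneg[OF u_carrier[of \<Delta> ?q] ex[of ?q]] by auto
    qed simp
    ultimately show ?case
      by (rule landau_o.big_trans[rotated])
  qed
qed

end
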